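(* Consider the panel stream and the W-TQA procedure described in the context, and fix any round $t\ge 1$. Let $\bar\alpha_t:=\min\{1,\max\{0,\alpha_t\}\}$. Then, almost surely, \[ \mathbb P\!\left(Y_{N+1,t}\notin C_t(X_{N+1,t})\,\middle|\,\mathcal F_{t-1}^{+}\right)\le \bar\alpha_t+\Delta_t,\qquad \Delta_t:=\sum_{k=1}^N w_{N+1,k}^{(t)}\,d_{\mathrm{TV}}\!\left(P_t,P_{t,k}^{\mathrm{swap}}\right). \]
   Context: All random quantities live on a common probability space $(\Omega,\mathcal A,\mathbb P)$; conditional laws are regular conditional laws. Panel stream. Fix integers $N\ge1$, $d\ge1$. For units $i=1,\dots,N+1$ and rounds $t=1,2,\dots$ there are random pairs $(X_{i,t},Y_{i,t})\in\mathbb R^d\times\mathbb R$; units $1,\dots,N$ are calibration units and unit $N+1$ is the target. No exchangeability is assumed. $R_t\in\{0,1\}$ indicates whether $Y_{N+1,t}$ is revealed (after prediction); by convention $R_0=0$ and $Y_{N+1,0}=0$. The batch observed at round $t$ is $\mathcal O_t=(X_{1,t},Y_{1,t},\dots,X_{N,t},Y_{N,t},X_{N+1,t},R_{t-1},R_{t-1}Y_{N+1,t-1})$. Set $\mathcal F_t=\sigma(\mathcal O_1,\dots,\mathcal O_t)$, $\mathcal F_0$ trivial, and $\mathcal F_t^{+}=\mathcal F_t\vee\sigma(R_t,R_tY_{N+1,t})$. Score. $\hat s:\mathbb R^d\times\mathbb R\to\mathbb R$ is a fixed (nonrandom) measurable function, and $\hat s_{i,t}:=\hat s(X_{i,t},Y_{i,t})$.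 W-TQA procedure, with parameters $\alpha\in[0,1]$, bandwidth $h>0$, stepsize $\gamma>0$. Initialize $\alpha_0=\alpha$, $\widehat\mu_{k,0}=0$, and $w^{(1)}_{N+1,k}=1/(N+1)$ for $k=1,\dots,N+1$. At each round $t=1,2,\dots$: (1) If $R_{t-1}=1$, set $\alpha_t=\alpha_{t-1}+\gamma(\alpha-\ell_{t-1})$, where $\ell_{t-1}=\mathbf 1\{Y_{N+1,t-1}\notin C_{t-1}(X_{N+1,t-1})\}$; otherwise set $\alpha_t=\alpha_{t-1}$. (2) Let $\widetilde s_t=(\hat s_{1,t},\dots,\hat s_{N,t},+\infty)$ and $\hat q_t=\inf\{q\in[-\infty,+\infty]:\sum_{k=1}^{N+1}w^{(t)}_{N+1,k}\mathbf 1\{(\widetilde s_t)_k\le q\}\ge 1-\alpha_t\}$, with $\inf\emptyset=+\infty$. The prediction set is $C_t(X_{N+1,t})=\{y\in\mathbb R:\hat s(X_{N+1,t},y)\le\hat q_t\}$ (so $\alpha_t>1$ gives the empty set, $\alpha_t<0$ gives $\mathbb R$). (3) Set $\widehat\mu_{k,t}=\frac1t\sum_{s=1}^tX_{k,s}$ for $k\le N+1$, $a_{k,t}=\exp\{-\|\widehat\mu_{k,t}-\widehat\mu_{N+1,t}\|_2^2/(2h^2)\}$ for $k\le N$, $a_{N+1,t}=1$, and $w^{(t+1)}_{N+1,k}=a_{k,t}/\sum_{j=1}^{N+1}a_{j,t}$ for $k\le N+1$. Laws. $P_t:=\mathcal L((\hat s_{1,t},\dots,\hat s_{N,t},\hat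 s_{N+1,t})\mid\mathcal F_{t-1}^{+})$, and for $k\in\{1,\dots,N\}$, $P_{t,k}^{\mathrm{swap}}$ is the conditional law given $\mathcal F_{t-1}^{+}$ of the vector obtained by swapping the $k$-th and $(N+1)$-th coordinates $\hat s_{k,t}$ and $\hat s_{N+1,t}$. $d_{\mathrm{TV}}(P,Q)=\sup_A|P(A)-Q(A)|$ is total variation distance. *)

theory Defs
  imports "HOL-Probability.Probability"
begin

text \<open>
  Units are indexed by \<open>{1..N + 1}\<close>, the target being unit \<open>N + 1\<close>. Only rounds \<open>t \<ge> 1\<close> carry data;
  at round \<open>0\<close> only the conventions \<open>R 0 = 0\<close> and \<open>Y (N + 1) 0 = 0\<close> matter.
\<close>

locale panel_stream = prob_space M
  for M :: "'w measure"
    and N :: nat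
    and X :: "nat \<Rightarrow> nat \<Rightarrow> 'w \<Rightarrow> real ^ 'd"
    and Y :: "nat \<Rightarrow> nat \<Rightarrow> 'w \<Rightarrow> real"
    and R :: "nat \<Rightarrow> 'w \<Rightarrow> real" +
  assumes N_pos: "N \<ge> 1"
    and X_measurable: "\<And>i t. i \<in> {1..N + 1} \<Longrightarrow> t \<ge> 1 \<Longrightarrow> X i t \<in> borel_measurable M"
    and Y_measurable: "\<And>i t. i \<in> {1..N + 1} \<Longrightarrow> t \<ge> 1 \<Longrightarrow> Y i t \<in> borel_measurable M"
    and R_measurable: "\<And>t. t \<ge> 1 \<Longrightarrow> R t \<in> borel_measurable M"
    and R_range: "\<And>t \<omega>. t \<ge> 1 \<Longrightarrow> \<omega> \<in> space M \<Longrightarrow> R t \<omega> \<in> {0, 1}"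
    and R_0: "\<And>\<omega>. \<omega> \<in> space M \<Longrightarrow> R 0 \<omega> = 0"
    and Y_0: "\<And>\<omega>. \<omega> \<in> space M \<Longrightarrow> Y (N + 1) 0 \<omega> = 0"

definition obs ::
  "nat \<Rightarrow> (nat \<Rightarrow> nat \<Rightarrow> 'w \<Rightarrow> real ^ 'd) \<Rightarrow> (nat \<Rightarrow> nat \<Rightarrow> 'w \<Rightarrow> real) \<Rightarrow> (nat \<Rightarrow> 'w \<Rightarrow> real)
    \<Rightarrow> nat \<Rightarrow> 'w \<Rightarrow> (nat \<Rightarrow> (real ^ 'd) \<times> real) \<times> (real ^ 'd) \<times> real \<times> real"
  where "obs N X Y R t \<omega> =
    ((\<lambda>i\<in>{1..N}. (X i t \<omega>, Y i t \<omega>)), X (N + 1) t \<omega>, R (t - 1) \<omega>, R (t - 1) \<omega> * Y (N + 1) (t - 1) \<omega>)"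

definition obs_space ::
  "nat \<Rightarrow> ((nat \<Rightarrow> (real ^ 'd) \<times> real) \<times> (real ^ 'd) \<times> real \<times> real) measure"
  where "obs_space N = (\<Pi>\<^sub>M i\<in>{1..N}. borel \<Otimes>\<^sub>M borel) \<Otimes>\<^sub>M borel \<Otimes>\<^sub>M borel \<Otimes>\<^sub>M borel"

definition hist ::
  "'w measure \<Rightarrow> nat \<Rightarrow> (nat \<Rightarrow> nat \<Rightarrow> 'w \<Rightarrow> real ^ 'd) \<Rightarrow> (nat \<Rightarrow> nat \<Rightarrow> 'w \<Rightarrow> real)
    \<Rightarrow> (nat \<Rightarrow> 'w \<Rightarrow> real) \<Rightarrow> nat \<Rightarrow> 'w measure"
  where "hist M N X Y R t =
    sigma (space M) (\<Union>s\<in>{1..t}. sets (vimage_algebra (space M) (obs N X Y R s) (obs_space N)))"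

definition hist_plus ::
  "'w measure \<Rightarrow> nat \<Rightarrow> (nat \<Rightarrow> nat \<Rightarrow> 'w \<Rightarrow> real ^ 'd) \<Rightarrow> (nat \<Rightarrow> nat \<Rightarrow> 'w \<Rightarrow> real)
    \<Rightarrow> (nat \<Rightarrow> 'w \<Rightarrow> real) \<Rightarrow> nat \<Rightarrow> 'w measure"
  where "hist_plus M N X Y R t =
    sigma (space M) (sets (hist M N X Y R t) \<union>
      sets (vimage_algebra (space M) (\<lambda>\<omega>. (R t \<omega>, R t \<omega> * Y (N + 1) t \<omega>)) (borel \<Otimes>\<^sub>M borel)))"

definition mean_cov :: "(nat \<Rightarrow> nat \<Rightarrow> 'w \<Rightarrow> real ^ 'd) \<Rightarrow> nat \<Rightarrow> nat \<Rightarrow> 'w \<Rightarrow> real ^ 'd"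
  where "mean_cov X k t \<omega> = (1 / real t) *\<^sub>R (\<Sum>s = 1..t. X k s \<omega>)"

definition affinity ::
  "nat \<Rightarrow> real \<Rightarrow> (nat \<Rightarrow> nat \<Rightarrow> 'w \<Rightarrow> real ^ 'd) \<Rightarrow> nat \<Rightarrow> nat \<Rightarrow> 'w \<Rightarrow> real"
  where "affinity N h X k t \<omega> =
    (if k = N + 1 then 1
     else exp (- (norm (mean_cov X k t \<omega> - mean_cov X (N + 1) t \<omega>))\<^sup>2 / (2 * h\<^sup>2)))"

text \<open>\<open>weight N h X t k\<close> is the weight of unit \<open>k\<close> used in round \<open>t\<close>, computed from rounds before \<open>t\<close>.\<close>

definition weight ::
  "nat \<Rightarrow> real \<Rightarrow> (nat \<Rightarrow> nat \<Rightarrow> 'w \<Rightarrow> real ^ 'd) \<Rightarrow> nat \<Rightarrow> nat \<Rightarrow> 'w \<Rightarrow> real"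
  where "weight N h X t k \<omega> =
    (if t \<le> 1 then 1 / real (N + 1)
     else affinity N h X k (t - 1) \<omega> / (\<Sum>j = 1..N + 1. affinity N h X j (t - 1) \<omega>))"

definition aug_score ::
  "nat \<Rightarrow> (real ^ 'd \<Rightarrow> real \<Rightarrow> real) \<Rightarrow> (nat \<Rightarrow> nat \<Rightarrow> 'w \<Rightarrow> real ^ 'd) \<Rightarrow> (nat \<Rightarrow> nat \<Rightarrow> 'w \<Rightarrow> real)
    \<Rightarrow> nat \<Rightarrow> nat \<Rightarrow> 'w \<Rightarrow> ereal"
  where "aug_score N shat X Y t k \<omega> = (if k = N + 1 then \<infinity> else ereal (shat (X k t \<omega>) (Y k t \<omega>)))"

text \<open>The threshold at miscoverage level \<open>a\<close>; the infimum is over \<open>ereal\<close>, where \<open>Inf {} = \<infinity>\<close>.\<close>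

definition threshold ::
  "nat \<Rightarrow> (real ^ 'd \<Rightarrow> real \<Rightarrow> real) \<Rightarrow> real \<Rightarrow> (nat \<Rightarrow> nat \<Rightarrow> 'w \<Rightarrow> real ^ 'd)
    \<Rightarrow> (nat \<Rightarrow> nat \<Rightarrow> 'w \<Rightarrow> real) \<Rightarrow> nat \<Rightarrow> real \<Rightarrow> 'w \<Rightarrow> ereal"
  where "threshold N shat h X Y t a \<omega> =
    Inf {q. (\<Sum>k = 1..N + 1. weight N h X t k \<omega> * of_bool (aug_score N shat X Y t k \<omega> \<le> q)) \<ge> 1 - a}"

definition level_set ::
  "nat \<Rightarrow> (real ^ 'd \<Rightarrow> real \<Rightarrow> real) \<Rightarrow> real \<Rightarrow> (nat \<Rightarrow> nat \<Rightarrow> 'w \<Rightarrow> real ^ 'd)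
    \<Rightarrow> (nat \<Rightarrow> nat \<Rightarrow> 'w \<Rightarrow> real) \<Rightarrow> nat \<Rightarrow> real \<Rightarrow> 'w \<Rightarrow> real ^ 'd \<Rightarrow> real set"
  where "level_set N shat h X Y t a \<omega> x = {y. ereal (shat x y) \<le> threshold N shat h X Y t a \<omega>}"

primrec alpha_seq ::
  "nat \<Rightarrow> (real ^ 'd \<Rightarrow> real \<Rightarrow> real) \<Rightarrow> real \<Rightarrow> real \<Rightarrow> real \<Rightarrow> (nat \<Rightarrow> nat \<Rightarrow> 'w \<Rightarrow> real ^ 'd)
    \<Rightarrow> (nat \<Rightarrow> nat \<Rightarrow> 'w \<Rightarrow> real) \<Rightarrow> (nat \<Rightarrow> 'w \<Rightarrow> real) \<Rightarrow> nat \<Rightarrow> 'w \<Rightarrow> real"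
  where
    "alpha_seq N shat \<alpha> h \<gamma> X Y R 0 \<omega> = \<alpha>"
  | "alpha_seq N shat \<alpha> h \<gamma> X Y R (Suc t) \<omega> =
      (if R t \<omega> = 1
       then alpha_seq N shat \<alpha> h \<gamma> X Y R t \<omega>
            + \<gamma> * (\<alpha> - of_bool (Y (N + 1) t \<omega> \<notin>
                level_set N shat h X Y t (alpha_seq N shat \<alpha> h \<gamma> X Y R t \<omega>) \<omega> (X (N + 1) t \<omega>)))
       else alpha_seq N shat \<alpha> h \<gamma> X Y R t \<omega>)"

definition pred_set ::
  "nat \<Rightarrow> (real ^ 'd \<Rightarrow> real \<Rightarrow> real) \<Rightarrow> real \<Rightarrow> real \<Rightarrow> real \<Rightarrow> (nat \<Rightarrow> nat \<Rightarrow> 'w \<Rightarrow> real ^ 'd)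
    \<Rightarrow> (nat \<Rightarrow> nat \<Rightarrow> 'w \<Rightarrow> real) \<Rightarrow> (nat \<Rightarrow> 'w \<Rightarrow> real) \<Rightarrow> nat \<Rightarrow> 'w \<Rightarrow> real ^ 'd \<Rightarrow> real set"
  where "pred_set N shat \<alpha> h \<gamma> X Y R t \<omega> x =
    level_set N shat h X Y t (alpha_seq N shat \<alpha> h \<gamma> X Y R t \<omega>) \<omega> x"

definition score_vec ::
  "nat \<Rightarrow> (real ^ 'd \<Rightarrow> real \<Rightarrow> real) \<Rightarrow> (nat \<Rightarrow> nat \<Rightarrow> 'w \<Rightarrow> real ^ 'd) \<Rightarrow> (nat \<Rightarrow> nat \<Rightarrow> 'w \<Rightarrow> real)
    \<Rightarrow> nat \<Rightarrow> 'w \<Rightarrow> nat \<Rightarrow> real"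
  where "score_vec N shat X Y t \<omega> = (\<lambda>i\<in>{1..N + 1}. shat (X i t \<omega>) (Y i t \<omega>))"

definition swap_coords :: "nat \<Rightarrow> nat \<Rightarrow> (nat \<Rightarrow> real) \<Rightarrow> nat \<Rightarrow> real"
  where "swap_coords k l v = v(k := v l, l := v k)"

text \<open>
  \<open>\<kappa>\<close> is a version of the regular conditional law of the \<open>S\<close>-valued random element \<open>Z\<close> given \<open>F\<close>.
\<close>

definition reg_cond_law ::
  "'w measure \<Rightarrow> 'w measure \<Rightarrow> 'b measure \<Rightarrow> ('w \<Rightarrow> 'b) \<Rightarrow> ('w \<Rightarrow> 'b measure) \<Rightarrow> bool"
  where "reg_cond_law M F S Z \<kappa> \<longleftrightarrow>
    Z \<in> M \<rightarrow>\<^sub>M S \<and> \<kappa> \<in> F \<rightarrow>\<^sub>M prob_algebra S \<and>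
    (\<forall>B\<in>sets S. AE \<omega> in M.
      measure (\<kappa> \<omega>) B = real_cond_exp M F (indicator (Z -` B \<inter> space M)) \<omega>)"

definition tv_dist :: "'b measure \<Rightarrow> 'b measure \<Rightarrow> real"
  where "tv_dist P Q = (SUP A\<in>sets P. \<bar>measure P A - measure Q A\<bar>)"

end

(*
  Unit k is called heavy in a score vector v if the units with scores strictly below v_k carry weight
  at least 1 - a.  A miscoverage at round t means that the target is heavy.  As no weight exceeds that
  of the target, swapping coordinates k and N + 1 then makes unit k heavy, so the conditional
  miscoverage probability is at most the P_t-probability that k is heavy plus d_TV(P_t, P_{t,k}^swap).
  Averaging over k with the weights gives the bound: in any vector the heavy units have total weight
  at most a, since the units not below the lowest heavy one weigh at most a.  The random weights and
  level are known at F_{t-1}^+, and heaviness depends on them only through the finite family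
  of index sets of weight at least 1 - a.
*)

theory Submission
  imports Defs
begin

section \<open>Weights: positivity, normalisation, dominance of the target\<close>

lemma affinity_bounds:
  shows affinity_pos: "0 < affinity N h X k t \<omega>"
    and affinity_le_1: "affinity N h X k t \<omega> \<le> 1"
    and affinity_target: "affinity N h X (N + 1) t \<omega> = 1"
  by (auto simp: affinity_def)

lemma sum_affinity_pos: "0 < (\<Sum>j = 1..N + 1. affinity N h X j t \<omega>)"
  by (intro sum_pos affinity_pos) auto

lemma weight_nonneg: "0 \<le> weight N h X t k \<omega>"
  using sum_affinity_pos[of N h X "t - 1" \<omega>] affinity_pos[of N h X k "t - 1" \<omega>]
  by (simp add: weight_def)

lemma sum_weight: "(\<Sum>k = 1..N + 1. weight N h X t k \<omega>) = 1"
proof (cases "t \<le> 1")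
  case True
  then have "(\<Sum>k = 1..N + 1. weight N h X t k \<omega>) = (\<Sum>k = 1..N + 1. 1 / real (N + 1))"
    by (intro sum.cong) (auto simp: weight_def)
  also have "\<dots> = 1"
    by (simp only: sum_constant) (simp add: field_simps)
  finally show ?thesis .
next
  case False
  then have "(\<Sum>k = 1..N + 1. weight N h X t k \<omega>)
    = (\<Sum>k = 1..N + 1. affinity N h X k (t - 1) \<omega> / (\<Sum>j = 1..N + 1. affinity N h X j (t - 1) \<omega>))"
    by (intro sum.cong) (auto simp: weight_def)
  also have "\<dots> = 1"
    using sum_affinity_pos[of N h X "t - 1" \<omega>] by (simp only: sum_divide_distrib[symmetric]) simp
  finally show ?thesis .
qed

text \<open>A Gaussian kernel never exceeds 1, which is the affinity of the target, and the
  normalising sum is common to all units. In the first round all weights agree.\<close>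

lemma weight_le_target: "weight N h X t k \<omega> \<le> weight N h X t (N + 1) \<omega>"
  using sum_affinity_pos[of N h X "t - 1" \<omega>] affinity_le_1[of N h X k "t - 1" \<omega>]
  by (simp only: weight_def affinity_target) (auto intro: divide_right_mono)

section \<open>Miscoverage as a condition on the weight strictly below the target score\<close>

text \<open>If a score exceeds the weighted quantile, the largest calibration score below it (or \<open>- \<infinity>\<close>, if
  there is none) already satisfies the quantile condition; this removes the infimum.\<close>

lemma not_in_level_set_iff:
  "y \<notin> level_set N shat h X Y t a \<omega> x \<longleftrightarrow>
    1 - a \<le> (\<Sum>k | k \<in> {1..N} \<and> shat (X k t \<omega>) (Y k t \<omega>) < shat x y. weight N h X t k \<omega>)"
    (is "_ \<longleftrightarrow> _ \<le> sum ?w ?J")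
proof -
  let ?s = "\<lambda>k. shat (X k t \<omega>) (Y k t \<omega>)"
  \<comment> \<open>For \<open>q < \<infinity>\<close> the target, whose augmented score is
    \<open>\<infinity>\<close>, contributes nothing, so only calibration units remain.\<close>
  have split: "(\<Sum>k = 1..N + 1. ?w k * of_bool (aug_score N shat X Y t k \<omega> \<le> q))
      = (\<Sum>k | k \<in> {1..N} \<and> ereal (?s k) \<le> q. ?w k)" if "q < \<infinity>" for q
  proof -
    have "(\<Sum>k = 1..N + 1. ?w k * of_bool (aug_score N shat X Y t k \<omega> \<le> q))
        = (\<Sum>k = 1..N. ?w k * of_bool (ereal (?s k) \<le> q))"
      using that by (simp add: aug_score_def)
    also have "\<dots> = (\<Sum>k \<in> {1..N} \<inter> {k. ereal (?s k) \<le> q}. ?w k)"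
      by (simp add: of_bool_def if_distrib sum.inter_restrict cong: if_cong)
    also have "\<dots> = (\<Sum>k | k \<in> {1..N} \<and> ereal (?s k) \<le> q. ?w k)"
      by (rule sum.cong) auto
    finally show ?thesis .
  qed
  have "y \<notin> level_set N shat h X Y t a \<omega> x \<longleftrightarrow> (\<exists>q < ereal (shat x y).
      1 - a \<le> (\<Sum>k = 1..N + 1. ?w k * of_bool (aug_score N shat X Y t k \<omega> \<le> q)))"
    unfolding level_set_def threshold_def by (auto simp: not_le Inf_less_iff)
  also have "\<dots> \<longleftrightarrow>
      (\<exists>q < ereal (shat x y). 1 - a \<le> (\<Sum>k | k \<in> {1..N} \<and> ereal (?s k) \<le> q. ?w k))"
  proof (intro ex_cong1 conj_cong refl)
    fix q assume "q < ereal (shat x y)"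
    then have "q < \<infinity>" by (cases q) auto
    then show "1 - a \<le> (\<Sum>k = 1..N + 1. ?w k * of_bool (aug_score N shat X Y t k \<omega> \<le> q))
      \<longleftrightarrow> 1 - a \<le> (\<Sum>k | k \<in> {1..N} \<and> ereal (?s k) \<le> q. ?w k)"
      by (simp only: split)
  qed
  also have "\<dots> \<longleftrightarrow> 1 - a \<le> sum ?w ?J"
  proof
    assume "\<exists>q < ereal (shat x y). 1 - a \<le> (\<Sum>k | k \<in> {1..N} \<and> ereal (?s k) \<le> q. ?w k)"
    then obtain q where q: "q < ereal (shat x y)"
      "1 - a \<le> (\<Sum>k | k \<in> {1..N} \<and> ereal (?s k) \<le> q. ?w k)" by blast
    have "(\<Sum>k | k \<in> {1..N} \<and> ereal (?s k) \<le> q. ?w k) \<le> sum ?w ?J"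
      using q(1) by (intro sum_mono2 weight_nonneg) (auto dest: le_less_trans)
    with q(2) show "1 - a \<le> sum ?w ?J" by linarith
  next
    assume J: "1 - a \<le> sum ?w ?J"
    define q where "q = Max (insert (- \<infinity>) ((\<lambda>k. ereal (?s k)) ` ?J))"
    have "q < ereal (shat x y)" by (auto simp: q_def)
    moreover have "{k. k \<in> {1..N} \<and> ereal (?s k) \<le> q} = ?J"
    proof (intro set_eqI iffI; clarsimp)
      fix k assume "ereal (?s k) \<le> q"
      with \<open>q < ereal (shat x y)\<close> have "ereal (?s k) < ereal (shat x y)" by (metis le_less_trans)
      then show "?s k < shat x y" by simp
    next
      fix k assume "Suc 0 \<le> k" "k \<le> N" "?s k < shat x y"
      then show "ereal (?s k) \<le> q" unfolding q_def by (intro Max_ge) auto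
    qed
    ultimately show "\<exists>q < ereal (shat x y). 1 - a \<le> (\<Sum>k | k \<in> {1..N} \<and> ereal (?s k) \<le> q. ?w k)"
      using J by auto
  qed
  finally show ?thesis .
qed

section \<open>Deterministic facts about heavy units\<close>

text \<open>Take a heavy unit \<open>k\<close> with the least score. Every heavy unit then lies in
  the complement of the units strictly below \<open>k\<close>, and this complement weighs at most
  \<open>a\<close>. If no unit is heavy the sum is 0, which is why negative levels may be clipped;
  clipping at 1 comes from the total weight.\<close>

lemma sum_weight_heavy_below_le:
  fixes w :: "'i \<Rightarrow> real" and u :: "'i \<Rightarrow> 'a::linorder"
  assumes "finite I" and w: "\<And>i. i \<in> I \<Longrightarrow> 0 \<le> w i" and "sum w I = 1"
  shows "(\<Sum>k | k \<in> I \<and> 1 - a \<le> (\<Sum>i | i \<in> I \<and> u i < u k. w i). w k) \<le> min 1 (max 0 a)"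
    (is "sum w ?S \<le> _")
proof (cases "?S = {}")
  case True
  show ?thesis unfolding True by simp
next
  case False
  have fin: "finite ?S" using assms(1) by simp
  obtain k where k: "k \<in> ?S" and min: "\<And>j. j \<in> ?S \<Longrightarrow> u k \<le> u j"
    using ex_min_if_finite[of "u ` ?S"] fin False by (auto simp: not_less)
  have "sum w ?S \<le> sum w {i \<in> I. u k \<le> u i}"
    using min assms by (intro sum_mono2) auto
  also have "\<dots> = 1 - (\<Sum>i | i \<in> I \<and> u i < u k. w i)"
  proof -
    have "sum w I = sum w {i \<in> I. u k \<le> u i} + sum w {i \<in> I. u i < u k}"
      using assms(1) by (subst sum.union_disjoint[symmetric]) (auto intro!: arg_cong[of _ _ "sum w"])
    then show ?thesis using assms(3) by simp
  qed
  also have "\<dots> \<le> a" using k by auto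
  finally have "sum w ?S \<le> a" .
  moreover have "sum w ?S \<le> sum w I" using assms by (intro sum_mono2) auto
  ultimately show ?thesis using assms(3) by auto
qed

text \<open>After the swap unit \<open>k\<close> carries the score \<open>v (N + 1)\<close>. If
  \<open>k\<close> was below the target, the set of units below this score changes only in that
  \<open>N + 1\<close> replaces \<open>k\<close>, which cannot lower the weight because
  \<open>w k \<le> w (N + 1)\<close>. Otherwise no unit is lost.\<close>

lemma sum_below_swap_coords_ge:
  fixes w :: "nat \<Rightarrow> real"
  assumes k: "k \<in> {1..N}" and le: "w k \<le> w (N + 1)" and w: "\<And>i. 0 \<le> w i"
  shows "(\<Sum>i | i \<in> {1..N + 1} \<and> v i < v (N + 1). w i)
    \<le> (\<Sum>i | i \<in> {1..N + 1} \<and> swap_coords k (N + 1) v i < swap_coords k (N + 1) v k. w i)"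
    (is "sum w ?A \<le> sum w ?B")
proof (cases "v k < v (N + 1)")
  case True
  have "?B = insert (N + 1) (?A - {k})" "N + 1 \<notin> ?A - {k}"
    using k True by (auto simp: swap_coords_def split: if_splits)
  then have "sum w ?B = w (N + 1) + sum w (?A - {k})" by simp
  moreover have "sum w ?A = w k + sum w (?A - {k})"
    using k True by (intro sum.remove) auto
  ultimately show ?thesis using le by simp
next
  case False
  then have "?A \<subseteq> ?B" using k by (auto simp: swap_coords_def)
  then show ?thesis using w by (intro sum_mono2) auto
qed

section \<open>Events on score vectors and estimates of their probabilities\<close>

text \<open>A family of index sets stands in for the weights and the level. For finite
  \<open>I\<close> there are only finitely many families of subsets of \<open>I\<close>, so a random
  choice of \<open>\<J>\<close> among them selects from finitely many fixed measurable sets.\<close>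

definition below_in :: "nat set \<Rightarrow> nat set set \<Rightarrow> nat \<Rightarrow> (nat \<Rightarrow> real) set"
  where "below_in I \<J> k = {v \<in> space (\<Pi>\<^sub>M i\<in>I. borel). {i \<in> I. v i < v k} \<in> \<J>}"

text \<open>Whether the set of indices below \<open>v k\<close> equals a given \<open>J\<close> is
  decided by finitely many comparisons of coordinates, and only finitely many \<open>J\<close> are
  subsets of \<open>I\<close>.\<close>

lemma sets_below_in:
  assumes "finite I" "k \<in> I"
  shows "below_in I \<J> k \<in> sets (\<Pi>\<^sub>M i\<in>I. borel)"
proof -
  have "below_in I \<J> k = {v \<in> space (\<Pi>\<^sub>M i\<in>I. borel).
      \<exists>J \<in> \<J> \<inter> Pow I. \<forall>i \<in> I. i \<in> J \<longleftrightarrow> v i < v k}"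
  proof -
    have "{i \<in> I. v i < v k} \<in> \<J> \<longleftrightarrow> (\<exists>J \<in> \<J> \<inter> Pow I. \<forall>i \<in> I. i \<in> J \<longleftrightarrow> v i < v k)"
      for v :: "nat \<Rightarrow> real"
    proof
      assume "{i \<in> I. v i < v k} \<in> \<J>"
      then show "\<exists>J \<in> \<J> \<inter> Pow I. \<forall>i \<in> I. i \<in> J \<longleftrightarrow> v i < v k"
        by (intro bexI[of _ "{i \<in> I. v i < v k}"]) auto
    next
      assume "\<exists>J \<in> \<J> \<inter> Pow I. \<forall>i \<in> I. i \<in> J \<longleftrightarrow> v i < v k"
      then obtain J where "J \<in> \<J>" "J \<subseteq> I" "\<forall>i \<in> I. i \<in> J \<longleftrightarrow> v i < v k" by blast
      moreover from this have "{i \<in> I. v i < v k} = J" by blast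
      ultimately show "{i \<in> I. v i < v k} \<in> \<J>" by simp
    qed
    then show ?thesis by (simp add: below_in_def)
  qed
  also have "\<dots> \<in> sets (\<Pi>\<^sub>M i\<in>I. borel)"
  proof -
    have meas: "(\<lambda>v. v i) \<in> borel_measurable (\<Pi>\<^sub>M i\<in>I. borel :: real measure)" if "i \<in> I" for i
      using that by (rule measurable_component_singleton)
    have "{v \<in> space (\<Pi>\<^sub>M i\<in>I. borel). i \<in> J \<longleftrightarrow> v i < v k}
        \<in> sets (\<Pi>\<^sub>M i\<in>I. borel :: real measure)" if "i \<in> I" for i and J :: "nat set"
      using borel_measurable_less[OF meas[OF that] meas[OF assms(2)]]
      by (cases "i \<in> J") (auto intro: sets.sets_Collect_neg)
    then show ?thesis
      using assms(1)
      by (intro sets.sets_Collect_finite_Ex sets.sets_Collect_finite_All) auto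
  qed
  finally show ?thesis .
qed

text \<open>A real supremum dominates its members only when they are bounded above; for probability
  measures the bound 1 serves.\<close>

lemma abs_measure_diff_le_tv_dist:
  assumes "prob_space P" "prob_space Q" "B \<in> sets P"
  shows "\<bar>measure P B - measure Q B\<bar> \<le> tv_dist P Q"
  unfolding tv_dist_def
proof (rule cSUP_upper[OF assms(3)])
  show "bdd_above ((\<lambda>A. \<bar>measure P A - measure Q A\<bar>) ` sets P)"
  proof (rule bdd_aboveI2)
    fix A
    show "\<bar>measure P A - measure Q A\<bar> \<le> 1"
      using prob_space.prob_le_1[OF assms(1), of A] prob_space.prob_le_1[OF assms(2), of A]
        measure_nonneg[of P A] measure_nonneg[of Q A] by linarith
  qed
qed

text \<open>The left-hand side is the expectation of the weighted sum of indicators. This carries a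
  bound valid for each single score vector over to a law of score vectors.\<close>

lemma (in prob_space) weighted_sum_prob_le:
  assumes "finite I" and B: "\<And>k. k \<in> I \<Longrightarrow> B k \<in> events"
    and le: "\<And>v. v \<in> space M \<Longrightarrow> (\<Sum>k \<in> I. w k * indicator (B k) v) \<le> c"
  shows "(\<Sum>k \<in> I. w k * prob (B k)) \<le> c"
proof -
  have int: "integrable M (\<lambda>v. w k * indicator (B k) v)" if "k \<in> I" for k
    using B[OF that] by (intro integrable_mult_right) (simp add: less_top[symmetric])
  have "(\<Sum>k \<in> I. w k * prob (B k)) = expectation (\<lambda>v. \<Sum>k \<in> I. w k * indicator (B k) v)"
    using B by (subst Bochner_Integration.integral_sum[OF int]) auto
  also have "\<dots> \<le> expectation (\<lambda>v. c)"
    using int le by (intro integral_mono) auto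
  finally show ?thesis by (simp add: prob_space)
qed

section \<open>Conditional probability of an event chosen by the conditioning information\<close>

text \<open>On \<open>{J = j}\<close> the event is \<open>Z \<in> A j\<close>, and the indicator of \<open>{J = j}\<close> pulls out of the conditional
  expectation; countably many values \<open>j\<close> leave only a null set.\<close>

lemma (in prob_space) reg_cond_law_frozen:
  assumes F: "subalgebra M F" and law: "reg_cond_law M F S Z \<kappa>"
    and J: "J \<in> F \<rightarrow>\<^sub>M count_space \<C>" and "countable \<C>"
    and A: "\<And>j. A j \<in> sets S"
  shows "{\<omega> \<in> space M. Z \<omega> \<in> A (J \<omega>)} \<in> events"
    and "AE \<omega> in M. real_cond_exp M F (indicator {\<omega> \<in> space M. Z \<omega> \<in> A (J \<omega>)}) \<omega>
      = measure (\<kappa> \<omega>) (A (J \<omega>))"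
proof -
  interpret finite_measure_subalgebra M F
    using F by unfold_locales
  let ?E = "{\<omega> \<in> space M. Z \<omega> \<in> A (J \<omega>)}"
  have Z: "Z \<in> M \<rightarrow>\<^sub>M S" using law by (simp add: reg_cond_law_def)
  have spF: "space F = space M" using F by (simp add: subalgebra_def)
  have JC: "J \<omega> \<in> \<C>" if "\<omega> \<in> space M" for \<omega>
    using measurable_space[OF J] that by (simp add: spF)
  define D where "D j = J -` {j} \<inter> space M" for j
  have DF [measurable]: "D j \<in> sets F" for j
  proof (cases "j \<in> \<C>")
    case True
    then show ?thesis using measurable_sets[OF J, of "{j}"] by (simp add: D_def spF)
  next
    case False
    then have "D j = {}" using JC by (auto simp: D_def)
    then show ?thesis by simp
  qed
  have DM [measurable]: "D j \<in> events" for j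
    using DF F by (auto simp: subalgebra_def)
  have ZA [measurable]: "Z -` A j \<inter> space M \<in> events" for j
    using Z A by (rule measurable_sets)
  \<comment> \<open>Splitting along the countably many values of \<open>J\<close> makes the event
    measurable although \<open>A (J \<omega>)\<close> varies with \<open>\<omega>\<close>.\<close>
  have "?E = (\<Union>j \<in> \<C>. D j \<inter> (Z -` A j \<inter> space M))"
    using JC by (auto simp: D_def)
  moreover have "\<dots> \<in> events"
    using \<open>countable \<C>\<close> by (intro sets.countable_UN') auto
  ultimately show E [measurable]: "?E \<in> events" by simp
  have "AE \<omega> in M. \<omega> \<in> D j \<longrightarrow> real_cond_exp M F (indicator ?E) \<omega> = measure (\<kappa> \<omega>) (A j)" for j
  proof -
    have pull: "AE \<omega> in M. real_cond_exp M F (\<lambda>\<omega>. indicator (D j) \<omega> * indicator B \<omega>) \<omega>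
        = indicator (D j) \<omega> * real_cond_exp M F (indicator B) \<omega>" if [measurable]: "B \<in> events" for B
      by (rule real_cond_exp_mult) (auto simp: indicator_inter_arith[symmetric] less_top[symmetric])
    \<comment> \<open>Inside \<open>D j\<close> the index is frozen at \<open>j\<close>, so
      \<open>?E\<close> and the preimage of the fixed set \<open>A j\<close> coincide there.\<close>
    have "(\<lambda>\<omega>. indicator (D j) \<omega> * indicator ?E \<omega> :: real)
        = (\<lambda>\<omega>. indicator (D j) \<omega> * indicator (Z -` A j \<inter> space M) \<omega>)"
      by (auto simp: D_def indicator_def)
    moreover have "AE \<omega> in M. measure (\<kappa> \<omega>) (A j)
        = real_cond_exp M F (indicator (Z -` A j \<inter> space M)) \<omega>"
      using law A by (simp add: reg_cond_law_def)
    ultimately show ?thesis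
      using pull[OF E] pull[OF ZA[of j]] by (auto simp: indicator_def)
  qed
  then have "AE \<omega> in M. \<forall>j \<in> \<C>. \<omega> \<in> D j \<longrightarrow>
      real_cond_exp M F (indicator ?E) \<omega> = measure (\<kappa> \<omega>) (A j)"
    using \<open>countable \<C>\<close> by (subst AE_ball_countable) auto
  then show "AE \<omega> in M. real_cond_exp M F (indicator ?E) \<omega> = measure (\<kappa> \<omega>) (A (J \<omega>))"
    using JC AE_space by (auto simp: D_def)
qed

section \<open>Measurability of weights and levels with respect to past observations\<close>

lemma measurable_mean_cov:
  assumes "\<And>s. s \<in> {1..t} \<Longrightarrow> X k s \<in> borel_measurable F"
  shows "mean_cov X k t \<in> borel_measurable F"
proof -
  have "(\<lambda>\<omega>. (1 / real t) *\<^sub>R (\<Sum>s = 1..t. X k s \<omega>)) \<in> borel_measurable F"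
    using assms by (intro borel_measurable_scaleR borel_measurable_sum) auto
  then show ?thesis by (simp add: mean_cov_def[abs_def])
qed

text \<open>The means entering the weights of round \<open>t\<close> stop at round
  \<open>t - 1\<close>, hence the strict bound \<open>s < t\<close>.\<close>

lemma measurable_weight:
  assumes X: "\<And>k s. k \<in> {1..N + 1} \<Longrightarrow> 1 \<le> s \<Longrightarrow> s < t \<Longrightarrow> X k s \<in> borel_measurable F"
    and k: "k \<in> {1..N + 1}"
  shows "weight N h X t k \<in> borel_measurable F"
proof (cases "t \<le> 1")
  case True
  then show ?thesis by (simp add: weight_def[abs_def])
next
  case False
  have "affinity N h X j (t - 1) \<in> borel_measurable F" if "j \<in> {1..N + 1}" for j
  proof -
    have mean: "mean_cov X i (t - 1) \<in> borel_measurable F" if "i \<in> {1..N + 1}" for i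
      using False by (intro measurable_mean_cov X that) auto
    have [measurable]: "mean_cov X j (t - 1) \<in> borel_measurable F"
      "mean_cov X (N + 1) (t - 1) \<in> borel_measurable F"
      using that by (intro mean; simp)+
    show ?thesis unfolding affinity_def[abs_def] by measurable
  qed
  then have "(\<lambda>\<omega>. affinity N h X k (t - 1) \<omega> / (\<Sum>j = 1..N + 1. affinity N h X j (t - 1) \<omega>))
      \<in> borel_measurable F"
    using k by (intro borel_measurable_divide borel_measurable_sum) auto
  then show ?thesis using False by (simp add: weight_def[abs_def])
qed

text \<open>A target response affects the level only when \<open>R t \<omega> = 1\<close>, and then
  it equals the revealed product \<open>R t \<omega> * Y (N + 1) t \<omega>\<close>. So feedback
  from rounds 1 to \<open>n\<close> determines the levels up to round \<open>Suc n\<close>, even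
  where responses stay hidden.\<close>

lemma measurable_alpha_seq:
  fixes X :: "nat \<Rightarrow> nat \<Rightarrow> 'w \<Rightarrow> real ^ 'd"
  assumes shat: "(\<lambda>(x, y). shat x y) \<in> borel_measurable (borel \<Otimes>\<^sub>M borel)"
    and X: "\<And>k s. k \<in> {1..N + 1} \<Longrightarrow> s \<in> {1..n} \<Longrightarrow> X k s \<in> borel_measurable F"
    and Y: "\<And>k s. k \<in> {1..N} \<Longrightarrow> s \<in> {1..n} \<Longrightarrow> Y k s \<in> borel_measurable F"
    and R: "\<And>s. s \<in> {1..n} \<Longrightarrow> R s \<in> borel_measurable F"
    and RY: "\<And>s. s \<in> {1..n} \<Longrightarrow> (\<lambda>\<omega>. R s \<omega> * Y (N + 1) s \<omega>) \<in> borel_measurable F"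
    and R0: "\<And>\<omega>. \<omega> \<in> space F \<Longrightarrow> R 0 \<omega> = 0"
  shows "t \<le> Suc n \<Longrightarrow> alpha_seq N shat \<alpha> h \<gamma> X Y R t \<in> borel_measurable F"
proof (induction t)
  case (Suc t)
  let ?a = "alpha_seq N shat \<alpha> h \<gamma> X Y R"
  have [measurable]: "?a t \<in> borel_measurable F" using Suc by simp
  show ?case
  proof (cases "t = 0")
    case True
    \<comment> \<open>Since \<open>R 0\<close> vanishes, the first update does nothing and the level
      stays at \<open>\<alpha>\<close>.\<close>
    have "?a 1 \<in> borel_measurable F \<longleftrightarrow> (\<lambda>\<omega>. \<alpha>) \<in> borel_measurable F"
      by (intro measurable_cong) (simp add: R0)
    then show ?thesis using True by (simp del: alpha_seq.simps)
  next
    case False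
    with Suc have t: "t \<in> {1..n}" by auto
    have score: "(\<lambda>\<omega>. shat (f \<omega>) (g \<omega>)) \<in> borel_measurable F"
      if "f \<in> borel_measurable F" "g \<in> borel_measurable F" for f g
      using measurable_compose[OF measurable_Pair[OF that] shat] by simp
    let ?y = "\<lambda>\<omega>. R t \<omega> * Y (N + 1) t \<omega>"
    let ?m = "\<lambda>\<omega>. \<Sum>k \<in> {1..N}. if shat (X k t \<omega>) (Y k t \<omega>) < shat (X (N + 1) t \<omega>) (?y \<omega>)
      then weight N h X t k \<omega> else 0"
    have m [measurable]: "?m \<in> borel_measurable F"
    proof (intro borel_measurable_sum measurable_If)
      fix k assume k: "k \<in> {1..N}"
      show "weight N h X t k \<in> borel_measurable F"
        using k t by (intro measurable_weight X) auto
      show "{\<omega> \<in> space F. shat (X k t \<omega>) (Y k t \<omega>) < shat (X (N + 1) t \<omega>) (?y \<omega>)} \<in> sets F"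
        using k t by (intro borel_measurable_less score X Y RY) auto
    qed simp
    have [measurable]: "R t \<in> borel_measurable F" using t by (rule R)
    \<comment> \<open>The characterisation of miscoverage removes the infimum; on the branch
      \<open>R t \<omega> = 1\<close> replacing the response by \<open>?y \<omega>\<close> changes
      nothing.\<close>
    have "?a (Suc t) \<omega> = (if R t \<omega> = 1
        then ?a t \<omega> + \<gamma> * (\<alpha> - (if 1 - ?a t \<omega> \<le> ?m \<omega> then 1 else 0)) else ?a t \<omega>)" for \<omega>
      by (simp add: not_in_level_set_iff sum.inter_filter of_bool_def del: atLeastAtMost_iff)
    then show ?thesis
      by (subst measurable_cong[where g = "\<lambda>\<omega>. if R t \<omega> = 1
        then ?a t \<omega> + \<gamma> * (\<alpha> - (if 1 - ?a t \<omega> \<le> ?m \<omega> then 1 else 0)) else ?a t \<omega>"]) measurable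
  qed
qed (simp add: alpha_seq.simps(1)[abs_def])

section \<open>The filtration: what is known after each round\<close>

text \<open>Serves both \<open>hist\<close> and \<open>hist_plus\<close>, whose generators contain
  all preimages under the observed maps.\<close>

lemma measurable_sigma_vimage_algebra:
  assumes "sets (vimage_algebra \<Omega> f S) \<subseteq> A" "A \<subseteq> Pow \<Omega>" "f \<in> \<Omega> \<rightarrow> space S"
  shows "f \<in> sigma \<Omega> A \<rightarrow>\<^sub>M S"
proof (rule measurableI)
  fix B assume "B \<in> sets S"
  then have "f -` B \<inter> \<Omega> \<in> sets (vimage_algebra \<Omega> f S)" by (rule in_vimage_algebra)
  then show "f -` B \<inter> space (sigma \<Omega> A) \<in> sets (sigma \<Omega> A)"
    using assms by auto
qed (use assms in auto)

lemma sets_vimage_algebra_subset_Pow: "sets (vimage_algebra \<Omega> f S) \<subseteq> Pow \<Omega>"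
  using sets.space_closed[of "vimage_algebra \<Omega> f S"] by simp

lemma space_hist [simp]: "space (hist M N X Y R t) = space M"
  and space_hist_plus [simp]: "space (hist_plus M N X Y R t) = space M"
  by (simp_all add: hist_def hist_plus_def space_measure_of_conv)

lemma subalgebra_hist: "subalgebra (hist_plus M N X Y R t) (hist M N X Y R t)"
proof -
  have "sets (hist M N X Y R t) \<subseteq> Pow (space M)"
    using sets.space_closed[of "hist M N X Y R t"] by simp
  then show ?thesis
    by (auto simp: subalgebra_def hist_plus_def sets_vimage_algebra_subset_Pow sets_measure_of)
qed

lemma obs_measurable_hist_plus:
  assumes "s \<in> {1..t}"
  shows "obs N X Y R s \<in> hist_plus M N X Y R t \<rightarrow>\<^sub>M obs_space N"
proof -
  have "obs N X Y R s \<in> hist M N X Y R t \<rightarrow>\<^sub>M obs_space N"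
    unfolding hist_def
  proof (rule measurable_sigma_vimage_algebra)
    show "obs N X Y R s \<in> space M \<rightarrow> space (obs_space N)"
      by (auto simp: obs_def obs_space_def space_pair_measure space_PiM)
    show "sets (vimage_algebra (space M) (obs N X Y R s) (obs_space N))
        \<subseteq> (\<Union>s\<in>{1..t}. sets (vimage_algebra (space M) (obs N X Y R s) (obs_space N)))"
      using assms by (rule UN_upper)
  qed (intro UN_least sets_vimage_algebra_subset_Pow)
  then show ?thesis by (rule measurable_from_subalg[OF subalgebra_hist])
qed

lemma feedback_measurable_hist_plus:
  shows "(\<lambda>\<omega>. (R t \<omega>, R t \<omega> * Y (N + 1) t \<omega>)) \<in> hist_plus M N X Y R t \<rightarrow>\<^sub>M borel \<Otimes>\<^sub>M borel"
  unfolding hist_plus_def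
proof (rule measurable_sigma_vimage_algebra)
  show "sets (hist M N X Y R t) \<union>
      sets (vimage_algebra (space M) (\<lambda>\<omega>. (R t \<omega>, R t \<omega> * Y (N + 1) t \<omega>)) (borel \<Otimes>\<^sub>M borel))
    \<subseteq> Pow (space M)"
    using sets.space_closed[of "hist M N X Y R t"] by (simp add: sets_vimage_algebra_subset_Pow)
qed (auto simp: space_pair_measure)

lemma covariate_measurable_hist_plus:
  assumes "k \<in> {1..N + 1}" "s \<in> {1..t}"
  shows "X k s \<in> borel_measurable (hist_plus M N X Y R t)"
proof (cases "k = N + 1")
  case True
  have "(\<lambda>z. fst (snd z)) \<in> borel_measurable (obs_space N)" unfolding obs_space_def by measurable
  from measurable_compose[OF obs_measurable_hist_plus[OF assms(2)] this] True
  show ?thesis by (simp add: obs_def)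
next
  case False
  with assms have k: "k \<in> {1..N}" by auto
  then have "(\<lambda>z. fst (fst z k)) \<in> borel_measurable (obs_space N)"
    unfolding obs_space_def by measurable
  from measurable_compose[OF obs_measurable_hist_plus[OF assms(2)] this] k
  show ?thesis by (simp add: obs_def)
qed

lemma response_measurable_hist_plus:
  assumes "k \<in> {1..N}" "s \<in> {1..t}"
  shows "Y k s \<in> borel_measurable (hist_plus M N X Y R t)"
proof -
  have "(\<lambda>z. snd (fst z k)) \<in> borel_measurable (obs_space N)"
    using assms(1) unfolding obs_space_def by measurable
  from measurable_compose[OF obs_measurable_hist_plus[OF assms(2)] this] assms(1)
  show ?thesis by (simp add: obs_def)
qed

text \<open>Feedback of an earlier round \<open>s\<close> is reported in the last two components of
  the batch of round \<open>s + 1\<close>; feedback of round \<open>t\<close> itself is what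
  \<open>hist_plus\<close> adds to \<open>hist\<close>.\<close>

lemma
  fixes X :: "nat \<Rightarrow> nat \<Rightarrow> 'w \<Rightarrow> real ^ 'd"
  assumes "s \<le> t"
  shows reveal_measurable_hist_plus: "R s \<in> borel_measurable (hist_plus M N X Y R t)" (is ?A)
    and revealed_response_measurable_hist_plus:
      "(\<lambda>\<omega>. R s \<omega> * Y (N + 1) s \<omega>) \<in> borel_measurable (hist_plus M N X Y R t)" (is ?B)
proof -
  have "?A \<and> ?B"
  proof (cases "s = t")
    case True
    show ?thesis
      using measurable_compose[OF feedback_measurable_hist_plus measurable_fst, of R t Y N M X]
        measurable_compose[OF feedback_measurable_hist_plus measurable_snd, of R t Y N M X] True
      by simp
  next
    case False
    with assms have s: "s + 1 \<in> {1..t}" by auto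
    let ?O = "obs_space N :: ((nat \<Rightarrow> (real ^ 'd) \<times> real) \<times> (real ^ 'd) \<times> real \<times> real) measure"
    have fs: "(\<lambda>z. fst (snd (snd z))) \<in> borel_measurable ?O"
      "(\<lambda>z. snd (snd (snd z))) \<in> borel_measurable ?O"
      unfolding obs_space_def by measurable
    show ?thesis
      using measurable_compose[OF obs_measurable_hist_plus[OF s, of N X Y R M] fs(1)]
        measurable_compose[OF obs_measurable_hist_plus[OF s, of N X Y R M] fs(2)]
      by (simp add: obs_def)
  qed
  then show ?A ?B by auto
qed

context panel_stream
begin

text \<open>Round 0 is included because the batch of round 1 contains its feedback; there the
  convention makes the variable constant on \<open>space M\<close>.\<close>

lemma R_measurable_all [measurable]: "R s \<in> borel_measurable M"
proof (cases "s = 0")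
  case True
  have "R 0 \<in> borel_measurable M \<longleftrightarrow> (\<lambda>\<omega>. 0 :: real) \<in> borel_measurable M"
    by (intro measurable_cong) (simp add: R_0)
  with True show ?thesis by simp
qed (simp add: R_measurable)

lemma Y_target_measurable [measurable]: "Y (N + 1) s \<in> borel_measurable M"
proof (cases "s = 0")
  case True
  have "Y (N + 1) 0 \<in> borel_measurable M \<longleftrightarrow> (\<lambda>\<omega>. 0 :: real) \<in> borel_measurable M"
    by (intro measurable_cong) (use Y_0 in simp)
  with True show ?thesis by simp
qed (use Y_measurable in auto)

lemma subalgebra_hist_plus: "subalgebra M (hist_plus M N X Y R t)"
proof -
  have vimage: "sets (vimage_algebra (space M) f S) \<subseteq> events" if "f \<in> M \<rightarrow>\<^sub>M S" for f and S :: "'c measure"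
    using that by (simp add: measurable_iff_sets)
  have "obs N X Y R s \<in> M \<rightarrow>\<^sub>M obs_space N" if "s \<in> {1..t}" for s
    unfolding obs_def[abs_def] obs_space_def
    using that by (intro measurable_Pair measurable_restrict borel_measurable_times
        X_measurable Y_measurable R_measurable_all Y_target_measurable) auto
  then have hist: "sets (hist M N X Y R t) \<subseteq> events"
    unfolding hist_def
    by (subst sets_measure_of)
      (intro sets.sigma_sets_subset UN_least vimage sets_vimage_algebra_subset_Pow; simp)+
  have "(\<lambda>\<omega>. (R t \<omega>, R t \<omega> * Y (N + 1) t \<omega>)) \<in> M \<rightarrow>\<^sub>M borel \<Otimes>\<^sub>M borel" by measurable
  from hist vimage[OF this] have "sets (hist_plus M N X Y R t) \<subseteq> events"
    unfolding hist_plus_def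
    by (subst sets_measure_of) (auto intro!: sets.sigma_sets_subset dest: sets.sets_into_space)
  then show ?thesis by (simp add: subalgebra_def)
qed

end


text \<open>The random family takes finitely many values, and each value is fixed by the truth or
  failure of finitely many conditions \<open>c J\<close>. This provides the discrete measurable
  index at which conditional laws are frozen.\<close>

lemma measurable_Collect_Pow:
  assumes "finite I" and c: "\<And>J. J \<subseteq> I \<Longrightarrow> {\<omega> \<in> space F. c J \<omega>} \<in> sets F"
  shows "(\<lambda>\<omega>. {J. J \<subseteq> I \<and> c J \<omega>}) \<in> F \<rightarrow>\<^sub>M count_space (Pow (Pow I))"
proof -
  have fin: "finite (Pow I)" "finite (Pow (Pow I))" using assms(1) by auto
  have "(\<lambda>\<omega>. {J. J \<subseteq> I \<and> c J \<omega>}) -` {\<J>} \<inter> space F \<in> sets F" if "\<J> \<in> Pow (Pow I)" for \<J>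
  proof -
    have "(\<lambda>\<omega>. {J. J \<subseteq> I \<and> c J \<omega>}) -` {\<J>} \<inter> space F
        = {\<omega> \<in> space F. \<forall>J \<in> Pow I. c J \<omega> \<longleftrightarrow> J \<in> \<J>}"
    proof -
      have "{J. J \<subseteq> I \<and> c J \<omega>} = \<J> \<longleftrightarrow> (\<forall>J \<in> Pow I. c J \<omega> \<longleftrightarrow> J \<in> \<J>)" for \<omega>
        using that by blast
      then show ?thesis by auto
    qed
    also have "\<dots> \<in> sets F"
    proof (intro sets.sets_Collect_finite_All fin(1))
      fix J assume "J \<in> Pow I"
      then have "{\<omega> \<in> space F. c J \<omega>} \<in> sets F" by (intro c) auto
      then show "{\<omega> \<in> space F. c J \<omega> \<longleftrightarrow> J \<in> \<J>} \<in> sets F"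
        by (cases "J \<in> \<J>") (auto intro: sets.sets_Collect_neg)
    qed
    finally show ?thesis .
  qed
  then show ?thesis
    using fin(2) by (subst measurable_count_space_eq2) auto
qed

section \<open>Conditional miscoverage compared with the swapped laws and averaged over
  units\<close>

theorem theorem5p1:
  fixes M :: "'w measure"
    and N t :: nat
    and X :: "nat \<Rightarrow> nat \<Rightarrow> 'w \<Rightarrow> real ^ 'd"
    and Y :: "nat \<Rightarrow> nat \<Rightarrow> 'w \<Rightarrow> real"
    and R :: "nat \<Rightarrow> 'w \<Rightarrow> real"
    and shat :: "real ^ 'd \<Rightarrow> real \<Rightarrow> real"
    and \<alpha> h \<gamma> :: real
    and P :: "'w \<Rightarrow> (nat \<Rightarrow> real) measure"
    and Pswap :: "nat \<Rightarrow> 'w \<Rightarrow> (nat \<Rightarrow> real) measure"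
  assumes "panel_stream M N X Y R"
    and "(\<lambda>(x, y). shat x y) \<in> borel_measurable (borel \<Otimes>\<^sub>M borel)"
    and "0 \<le> \<alpha>" "\<alpha> \<le> 1" and "h > 0" and "\<gamma> > 0"
    and "t \<ge> 1"
    and "reg_cond_law M (hist_plus M N X Y R (t - 1)) (\<Pi>\<^sub>M i\<in>{1..N + 1}. borel)
           (score_vec N shat X Y t) P"
    and "\<And>k. k \<in> {1..N} \<Longrightarrow>
           reg_cond_law M (hist_plus M N X Y R (t - 1)) (\<Pi>\<^sub>M i\<in>{1..N + 1}. borel)
             (\<lambda>\<omega>. swap_coords k (N + 1) (score_vec N shat X Y t \<omega>)) (Pswap k)"
  shows "AE \<omega> in M.
    real_cond_exp M (hist_plus M N X Y R (t - 1))
      (indicator {\<omega> \<in> space M.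
         Y (N + 1) t \<omega> \<notin> pred_set N shat \<alpha> h \<gamma> X Y R t \<omega> (X (N + 1) t \<omega>)}) \<omega>
    \<le> min 1 (max 0 (alpha_seq N shat \<alpha> h \<gamma> X Y R t \<omega>))
      + (\<Sum>k = 1..N. weight N h X t k \<omega> * tv_dist (P \<omega>) (Pswap k \<omega>))"
proof -
  interpret panel_stream M N X Y R by fact
  define F where "F = hist_plus M N X Y R (t - 1)"
  define I where "I = {1..N + 1}"
  define S where "S = (\<Pi>\<^sub>M i\<in>I. borel :: real measure)"
  define a where "a = alpha_seq N shat \<alpha> h \<gamma> X Y R t"
  define w where "w \<omega> k = weight N h X t k \<omega>" for \<omega> k
  define V where "V = score_vec N shat X Y t"
  define Vsw where "Vsw k \<omega> = swap_coords k (N + 1) (V \<omega>)" for k \<omega>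
  \<comment> \<open>\<open>H \<omega>\<close> collects the index sets of weight at least
    \<open>1 - a \<omega>\<close>. Through it alone the random weights and level enter the events
    \<open>E Z k\<close>, which say that unit \<open>k\<close> is heavy in the vector
    \<open>Z\<close>.\<close>
  define H where "H \<omega> = {J. J \<subseteq> I \<and> 1 - a \<omega> \<le> sum (w \<omega>) J}" for \<omega>
  define E where "E Z k = {\<omega> \<in> space M. Z \<omega> \<in> below_in I (H \<omega>) k}"
    for Z :: "'w \<Rightarrow> nat \<Rightarrow> real" and k
  have finI: "finite I" and tgt: "N + 1 \<in> I" by (auto simp: I_def)
  have subalg: "subalgebra M F" unfolding F_def by (rule subalgebra_hist_plus)
  interpret FS: finite_measure_subalgebra M F using subalg by unfold_locales
  have spF: "space F = space M" by (simp add: F_def)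
  have lawV: "reg_cond_law M F S V P"
    using assms(8) by (simp only: F_def S_def I_def V_def)
  have lawsw: "reg_cond_law M F S (Vsw k) (Pswap k)" if "k \<in> {1..N}" for k
    using assms(9)[OF that] by (simp only: F_def S_def I_def V_def Vsw_def[abs_def])
  have w_meas: "(\<lambda>\<omega>. w \<omega> k) \<in> borel_measurable F" if "k \<in> I" for k
    using that unfolding w_def F_def I_def
    by (intro measurable_weight covariate_measurable_hist_plus) auto
  have a_meas: "a \<in> borel_measurable F"
    unfolding a_def F_def
  proof (rule measurable_alpha_seq[where n = "t - 1"])
    show "R 0 \<omega> = 0" if "\<omega> \<in> space (hist_plus M N X Y R (t - 1))" for \<omega>
      using that R_0 by simp
    show "(\<lambda>\<omega>. R s \<omega> * Y (N + 1) s \<omega>) \<in> borel_measurable (hist_plus M N X Y R (t - 1))"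
      if "s \<in> {1..t - 1}" for s
      using that by (intro revealed_response_measurable_hist_plus) auto
  qed (use assms(2,7) in \<open>auto intro: covariate_measurable_hist_plus response_measurable_hist_plus
      reveal_measurable_hist_plus\<close>)
  have H_meas: "H \<in> F \<rightarrow>\<^sub>M count_space (Pow (Pow I))"
    unfolding H_def[abs_def]
  proof (rule measurable_Collect_Pow[OF finI])
    fix J assume "J \<subseteq> I"
    then have "(\<lambda>\<omega>. sum (w \<omega>) J) \<in> borel_measurable F"
      using w_meas by (intro borel_measurable_sum) auto
    then show "{\<omega> \<in> space F. 1 - a \<omega> \<le> sum (w \<omega>) J} \<in> sets F"
      using a_meas by (intro borel_measurable_le) auto
  qed
  have count: "countable (Pow (Pow I))" using finI by (intro countable_finite) auto
  have B: "below_in I \<J> k \<in> sets S" if "k \<in> I" for \<J> k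
    unfolding S_def by (rule sets_below_in[OF finI that])
  have frozen: "E Z k \<in> events"
    "AE \<omega> in M. real_cond_exp M F (indicator (E Z k)) \<omega> = measure (\<kappa> \<omega>) (below_in I (H \<omega>) k)"
    if "reg_cond_law M F S Z \<kappa>" "k \<in> I" for Z \<kappa> k
    using reg_cond_law_frozen[OF subalg that(1) H_meas count, of "\<lambda>\<J>. below_in I \<J> k"]
      B[OF that(2)] by (simp_all add: E_def)
  have V_space: "V \<omega> \<in> space S" if "\<omega> \<in> space M" for \<omega>
    using lawV that by (auto simp: reg_cond_law_def dest: measurable_space)
  have Vsw_space: "Vsw k \<omega> \<in> space S" if "\<omega> \<in> space M" "k \<in> {1..N}" for \<omega> k
    using lawsw[OF that(2)] that by (auto simp: reg_cond_law_def dest: measurable_space)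
  have below_in_H: "v \<in> below_in I (H \<omega>) k \<longleftrightarrow> 1 - a \<omega> \<le> (\<Sum>i | i \<in> I \<and> v i < v k. w \<omega> i)"
    if "v \<in> space S" for v k \<omega>
    using that by (auto simp: below_in_def S_def H_def)
  have event: "{\<omega> \<in> space M.
      Y (N + 1) t \<omega> \<notin> pred_set N shat \<alpha> h \<gamma> X Y R t \<omega> (X (N + 1) t \<omega>)} = E V (N + 1)"
  proof -
    \<comment> \<open>The target is never strictly below itself, so passing from
      \<open>{1..N}\<close> to \<open>I\<close> adds no index.\<close>
    have "{i \<in> I. V \<omega> i < V \<omega> (N + 1)} = {k. k \<in> {1..N} \<and>
        shat (X k t \<omega>) (Y k t \<omega>) < shat (X (N + 1) t \<omega>) (Y (N + 1) t \<omega>)}" for \<omega>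
      by (auto simp: V_def score_vec_def I_def le_Suc_eq)
    then show ?thesis
      unfolding E_def pred_set_def not_in_level_set_iff
      by (intro Collect_cong conj_cong refl) (simp add: below_in_H V_space w_def a_def)
  qed
  have cond_swap: "AE \<omega> in M. measure (P \<omega>) (below_in I (H \<omega>) (N + 1))
      \<le> measure (Pswap k \<omega>) (below_in I (H \<omega>) k)" if k: "k \<in> {1..N}" for k
  proof -
    have kI: "k \<in> I" using k by (auto simp: I_def)
    have "E V (N + 1) \<subseteq> E (Vsw k) k"
    proof
      fix \<omega> assume \<omega>: "\<omega> \<in> E V (N + 1)"
      then have sp: "\<omega> \<in> space M" by (simp add: E_def)
      have "1 - a \<omega> \<le> (\<Sum>i | i \<in> I \<and> V \<omega> i < V \<omega> (N + 1). w \<omega> i)"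
        using \<omega> V_space[OF sp] by (simp add: E_def below_in_H)
      also have "\<dots> \<le> (\<Sum>i | i \<in> I \<and> Vsw k \<omega> i < Vsw k \<omega> k. w \<omega> i)"
        unfolding I_def Vsw_def using k
        by (rule sum_below_swap_coords_ge) (simp_all only: w_def weight_le_target weight_nonneg)
      finally show "\<omega> \<in> E (Vsw k) k"
        using sp Vsw_space[OF sp k] by (simp add: E_def below_in_H)
    qed
    \<comment> \<open>The inclusion between events holds pointwise; conditioning on \<open>F\<close>
      turns it into a comparison of the two conditional laws at the same family
      \<open>H \<omega>\<close>.\<close>
    then have "AE \<omega> in M. real_cond_exp M F (indicator (E V (N + 1))) \<omega>
        \<le> real_cond_exp M F (indicator (E (Vsw k) k)) \<omega>"
      using frozen(1)[OF lawV tgt] frozen(1)[OF lawsw[OF k] kI]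
      by (intro FS.real_cond_exp_mono) (auto simp: indicator_def less_top[symmetric])
    with frozen(2)[OF lawV tgt] frozen(2)[OF lawsw[OF k] kI] show ?thesis by eventually_elim simp
  qed
  have "AE \<omega> in M. \<forall>k \<in> {1..N}. measure (P \<omega>) (below_in I (H \<omega>) (N + 1))
      \<le> measure (Pswap k \<omega>) (below_in I (H \<omega>) k)"
    using cond_swap by (subst AE_ball_countable) auto
  with frozen(2)[OF lawV tgt] AE_space
  have "AE \<omega> in M. real_cond_exp M F (indicator (E V (N + 1))) \<omega>
      \<le> min 1 (max 0 (a \<omega>)) + (\<Sum>k = 1..N. w \<omega> k * tv_dist (P \<omega>) (Pswap k \<omega>))"
  proof eventually_elim
    case (elim \<omega>)
    let ?B = "below_in I (H \<omega>)" and ?tv = "\<lambda>k. tv_dist (P \<omega>) (Pswap k \<omega>)"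
    have "P \<omega> \<in> space (prob_algebra S)"
      using lawV elim(2) by (auto simp: reg_cond_law_def spF dest: measurable_space)
    then have P: "prob_space (P \<omega>)" "sets (P \<omega>) = sets S" by (auto simp: space_prob_algebra)
    have Ps: "prob_space (Pswap k \<omega>)" if "k \<in> {1..N}" for k
      using lawsw[OF that] elim(2)
      by (auto simp: reg_cond_law_def spF space_prob_algebra dest!: measurable_space)
    \<comment> \<open>The swap moves from the target under \<open>P \<omega>\<close> to unit
      \<open>k\<close> under \<open>Pswap k \<omega>\<close>; total variation, tested on
      \<open>?B k\<close>, returns to \<open>P \<omega>\<close>.\<close>
    have le: "measure (P \<omega>) (?B (N + 1)) \<le> measure (P \<omega>) (?B k) + ?tv k" if "k \<in> {1..N}" for k
    proof -
      have "k \<in> I" using that by (auto simp: I_def)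
      then show ?thesis
        using abs_measure_diff_le_tv_dist[OF P(1) Ps[OF that], of "?B k"] B[of k "H \<omega>"] P(2)
          elim(3) that by fastforce
    qed
    have split: "sum f I = sum f {1..N} + f (N + 1)" for f :: "nat \<Rightarrow> real"
      by (simp add: I_def)
    have w: "0 \<le> w \<omega> k" for k by (simp add: w_def weight_nonneg)
    have w1: "sum (w \<omega>) I = 1" unfolding I_def w_def by (rule sum_weight)
    \<comment> \<open>As the weights sum to 1, the probability is an average of copies of itself.
      Only the calibration copies are exchanged by \<open>le\<close>; the target copy stays and
      costs no total variation term.\<close>
    have "measure (P \<omega>) (?B (N + 1)) = (\<Sum>k \<in> I. w \<omega> k * measure (P \<omega>) (?B (N + 1)))"
      using w1 by (simp add: sum_distrib_right[symmetric])
    also have "\<dots> \<le> (\<Sum>k = 1..N. w \<omega> k * (measure (P \<omega>) (?B k) + ?tv k))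
        + w \<omega> (N + 1) * measure (P \<omega>) (?B (N + 1))"
      unfolding split using le w by (intro add_mono sum_mono mult_left_mono) auto
    also have "\<dots> = (\<Sum>k \<in> I. w \<omega> k * measure (P \<omega>) (?B k)) + (\<Sum>k = 1..N. w \<omega> k * ?tv k)"
      by (simp add: split distrib_left sum.distrib)
    \<comment> \<open>With \<open>\<omega>\<close> fixed, weights and level are constants, so the
      deterministic bound on heavy units applies to each \<open>v\<close> and is integrated against
      \<open>P \<omega>\<close>.\<close>
    also have "(\<Sum>k \<in> I. w \<omega> k * measure (P \<omega>) (?B k)) \<le> min 1 (max 0 (a \<omega>))"
    proof (rule prob_space.weighted_sum_prob_le[OF P(1) finI])
      fix v assume "v \<in> space (P \<omega>)"
      then have v: "v \<in> space S" using sets_eq_imp_space_eq[OF P(2)] by simp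
      have "(\<Sum>k \<in> I. w \<omega> k * indicator (?B k) v)
          = (\<Sum>k \<in> I. if 1 - a \<omega> \<le> (\<Sum>i | i \<in> I \<and> v i < v k. w \<omega> i) then w \<omega> k else 0)"
        by (intro sum.cong) (auto simp: indicator_def below_in_H[OF v])
      also have "\<dots> = sum (w \<omega>) {k \<in> I. 1 - a \<omega> \<le> (\<Sum>i | i \<in> I \<and> v i < v k. w \<omega> i)}"
        by (rule sum.inter_filter[OF finI, symmetric])
      also have "\<dots> \<le> min 1 (max 0 (a \<omega>))"
        using finI w w1 by (intro sum_weight_heavy_below_le) auto
      finally show "(\<Sum>k \<in> I. w \<omega> k * indicator (?B k) v) \<le> min 1 (max 0 (a \<omega>))" .
    qed (use B P(2) in auto)
    finally show ?case using elim(1) by simp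
  qed
  then show ?thesis
    unfolding event by (simp only: F_def a_def w_def)
qed

end
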